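(* Let $p$ be a prime, and let $s$ be a positive integer. (i) If $s$ is odd, then $$\mathcal{E}_{\max}(p^s) = \frac{1}{(p+1)^2}\left((s+1)(p^2-1)p^s + 2(p^{s+1}-1)\right).$$ If $p\geq 3$, the only exponent tuple $a$ satisfying $\mathcal{E}(p^s,\mathcal{D}(a)) = \mathcal{E}_{\max}(p^s)$ is $a=(0,2,4,\ldots,s-3,s-1)$ (all even integers from $0$ to $s-1$, in increasing order). If $p=2$, the exponent tuples $a$ satisfying $\mathcal{E}(p^s,\mathcal{D}(a)) = \mathcal{E}_{\max}(p^s)$ are exactly $a=(0,2,4,\ldots,s-3,s-1)$ and, when $s\geq 3$, additionally $a=(0,1,3,5,\ldots,s-4,s-2,s-1)$ (i.e. $0$, followed by all odd integers from $1$ to $s-2$, followed by $s-1$). (ii) If $s$ is even, then $$\mathcal{E}_{\max}(p^s) = \frac{1}{(p+1)^2}\left(s(p^2-1)p^s + 2(2p^{s+1}-p^{s-1}+p^2-p-1)\right),$$ and the exponent tuples $a$ satisfying $\mathcal{E}(p^s,\mathcal{D}(a)) = \mathcal{E}_{\max}(p^s)$ are exactly $a=(0,2,4,\ldots,s-2,s-1)$ (all even integers from $0$ to $s-2$, followed by $s-1$) and $a=(0,1,3,5,\ldots,s-3,s-1)$ ($0$ followed by all odd integers from $1$ to $s-1$); for $s=2$ these two tuples coincide.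
   Context: For a positive integer $n$ and a set $\mathcal{D}\subseteq\{1\le d<n : d\mid n\}$ of proper divisors of $n$, the integral circulant graph $\mathrm{ICG}(n,\mathcal{D})$ is the (simple, undirected) graph with vertex set $\mathbb{Z}/n\mathbb{Z}$ and edge set $\{\{a,b\} : a,b\in\mathbb{Z}/n\mathbb{Z},\ \gcd(a-b,n)\in\mathcal{D}\}$. The energy of a graph is the sum of the absolute values of the eigenvalues (with multiplicity) of its adjacency matrix. $\mathcal{E}(n,\mathcal{D})$ denotes the energy of $\mathrm{ICG}(n,\mathcal{D})$, and $\mathcal{E}_{\max}(n) := \max\{\mathcal{E}(n,\mathcal{D}) : \mathcal{D}\subseteq\{1\le d<n : d\mid n\}\}$. For a prime power $p^s$, an exponent tuple is a tuple $a=(a_1,\ldots,a_r)$ of integers, of any length $r\ge 1$, with $0\le a_1<a_2<\cdots<a_r\le s-1$; the corresponding divisor set is $\mathcal{D}(a):=\{p^{a_1},\ldots,p^{a_r}\}$. *)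

theory Defs
  imports "Jordan_Normal_Form.Char_Poly" Complex_Main
begin

text \<open>
  Graphs on the vertex set \<open>{..<n}\<close> are given by their set of (two-element) edges.
  The energy is taken over the complex eigenvalues, each counted with its algebraic
  multiplicity, i.e. its order as a root of the characteristic polynomial.
\<close>

definition adjacency_mat :: "nat \<Rightarrow> nat set set \<Rightarrow> complex mat" where
  "adjacency_mat n E = mat n n (\<lambda>(i, j). if {i, j} \<in> E then 1 else 0)"

definition graph_energy :: "nat \<Rightarrow> nat set set \<Rightarrow> real" where
  "graph_energy n E =
     (\<Sum>x | eigenvalue (adjacency_mat n E) x.
        real (order x (char_poly (adjacency_mat n E))) * cmod x)"

definition proper_divisors :: "nat \<Rightarrow> nat set" where
  "proper_divisors n = {d. 1 \<le> d \<and> d < n \<and> d dvd n}"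

text \<open>
  The vertices \<open>{..<n}\<close> represent the residue classes modulo \<open>n\<close>.  The difference is formed
  in the integers, since subtraction on the naturals truncates; its gcd with \<open>n\<close> depends
  only on the residue classes.  For a set \<open>D\<close> of proper divisors there are no loops,
  as \<open>gcd 0 n = n\<close>.
\<close>

definition icg_edges :: "nat \<Rightarrow> nat set \<Rightarrow> nat set set" where
  "icg_edges n D =
     {{a, b} | a b. a < n \<and> b < n \<and> gcd (int a - int b) (int n) \<in> int ` D}"

definition icg_energy :: "nat \<Rightarrow> nat set \<Rightarrow> real" where
  "icg_energy n D = graph_energy n (icg_edges n D)"

definition max_icg_energy :: "nat \<Rightarrow> real" where
  "max_icg_energy n = Max {icg_energy n D | D. D \<subseteq> proper_divisors n}"

definition exponent_tuple :: "nat \<Rightarrow> nat list \<Rightarrow> bool" where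
  "exponent_tuple s a \<longleftrightarrow> a \<noteq> [] \<and> sorted_wrt (<) a \<and> (\<forall>k \<in> set a. k \<le> s - 1)"

definition exponent_divisors :: "nat \<Rightarrow> nat list \<Rightarrow> nat set" where
  "exponent_divisors p a = {p ^ k | k. k \<in> set a}"

definition maximising_tuples :: "nat \<Rightarrow> nat \<Rightarrow> nat list set" where
  "maximising_tuples p s =
     {a. exponent_tuple s a \<and>
         icg_energy (p ^ s) (exponent_divisors p a) = max_icg_energy (p ^ s)}"

end

theory Submission
  imports Defs
begin

text \<open>
  Why the theorem holds.  Put \<open>n = p ^ s\<close> and let \<open>A \<subseteq> {0, \<dots>, s - 1}\<close> be a set of exponents.
  The adjacency matrix is circulant, hence diagonalised by the Fourier matrix, and each
  eigenvalue is a sum over \<open>a \<in> A\<close> of Ramanujan sums for the moduli \<open>p ^ (s - a)\<close>.  The \<open>k\<close>-th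
  eigenvalue depends only on the exact power of \<open>p\<close> dividing \<open>k\<close>, and it can be negative only
  when this power is \<open>p ^ (s - b - 1)\<close> with \<open>b \<in> A\<close>.  As the eigenvalues sum to \<open>0\<close>, the energy is
  twice the sum of the absolute values of the negative ones, which with \<open>q = 1 / p\<close> gives
  (\<open>icg_energy_prime_power\<close>)
  \<open>E(A) = 2 (p - 1) p ^ (s - 1) (|A| - (1 - q) \<Sum> q ^ (a - b - 1))\<close>,
  where the sum extends over all \<open>a, b \<in> A\<close> with \<open>b < a\<close>.

  It remains to maximise the bracket.  The idea is to read the indicator word of \<open>A\<close> from left
  to right and to remember only the penalty \<open>x\<close> that the next exponent would incur if it were
  chosen: choosing it earns \<open>1 - x\<close> and moves the penalty to \<open>q x + 1 - q\<close>, skipping it earns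
  nothing and moves the penalty to \<open>q x\<close>.  This turns the problem into dynamic programming.
  For \<open>0 < x < 1\<close> the first decision already forces the rest of an optimal word: after a choice
  the penalty exceeds \<open>1 - q\<close>, after a skip it is below \<open>q\<close>, and the threshold that decides the
  next letter is \<open>q\<close> or \<open>1 - q\<close> according to whether the number of remaining letters is even or
  odd, as long as there are at least two; the very last letter should always be a choice.  Since
  \<open>q \<le> 1 / 2\<close>, choices and skips alternate up to that last letter, so only two words of each length
  can be optimal (\<open>gain_less_candidates_even\<close>, \<open>gain_less_candidates_odd\<close>), and their
  gains are explicit affine functions of \<open>x\<close>.

  The process starts with penalty \<open>0\<close>, where the first letter must be a choice, which leads to
  the penalty \<open>1 - q\<close>.  This is exactly the threshold for an odd number of remaining letters,
  hence the two maximisers for even \<open>s\<close>.  For odd \<open>s \<ge> 3\<close> the threshold is \<open>q\<close>, which differs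
  from \<open>1 - q\<close> unless \<open>p = 2\<close>; hence the second maximiser for \<open>p = 2\<close> only.
\<close>

section \<open>Spectra of circulant matrices\<close>

definition unity_root :: "nat \<Rightarrow> int \<Rightarrow> complex" where
  "unity_root n t = cis (2 * pi * of_int t / of_nat n)"

lemma unity_root_add: "unity_root n (a + b) = unity_root n a * unity_root n b"
  by (simp add: unity_root_def cis_mult add_divide_distrib ring_distribs)

lemma unity_root_power: "unity_root n a ^ k = unity_root n (a * int k)"
  by (simp add: unity_root_def DeMoivre mult_ac)

lemma unity_root_eq_1_iff:
  assumes "n > 0"
  shows "unity_root n a = 1 \<longleftrightarrow> int n dvd a"
proof
  assume "unity_root n a = 1"
  hence "cos (2 * pi * of_int a / of_nat n) = 1"
    by (auto simp: unity_root_def complex_eq_iff)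
  then obtain m :: int where "2 * pi * of_int a / of_nat n = of_int m * 2 * pi"
    by (auto simp: cos_one_2pi_int)
  hence "real_of_int a = of_int (m * int n)"
    using assms by (simp add: field_simps)
  hence "a = m * int n" by (simp only: of_int_eq_iff)
  thus "int n dvd a" by simp
next
  assume "int n dvd a"
  then obtain m where "a = int n * m" by (elim dvdE)
  thus "unity_root n a = 1"
    using assms cis_multiple_2pi[of "of_int m"] by (simp add: unity_root_def mult.assoc)
qed

lemma unity_root_mod:
  assumes "n > 0"
  shows "unity_root n (a mod int n) = unity_root n a"
proof -
  have "unity_root n a = unity_root n (a mod int n + int n * (a div int n))" by simp
  also have "\<dots> = unity_root n (a mod int n)"
    unfolding unity_root_add using unity_root_eq_1_iff[OF assms] by simp
  finally show ?thesis ..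
qed

lemma unity_root_cancel:
  assumes "d > 0"
  shows "unity_root (d * e) (int d * a) = unity_root e a"
  using assms by (simp add: unity_root_def mult.assoc)

lemma sum_unity_root:
  assumes "n > 0"
  shows "(\<Sum>j<n. unity_root n (a * int j)) = of_nat n * of_bool (int n dvd a)"
proof -
  have "(\<Sum>j<n. unity_root n (a * int j)) = (\<Sum>j<n. unity_root n a ^ j)"
    by (simp add: unity_root_power)
  also have "\<dots> = of_nat n * of_bool (int n dvd a)"
  proof (cases "int n dvd a")
    case True
    thus ?thesis using unity_root_eq_1_iff[OF assms, of a] by simp
  next
    case False
    have "unity_root n a ^ n = 1"
      by (simp add: unity_root_power unity_root_eq_1_iff[OF assms])
    thus ?thesis using False unity_root_eq_1_iff[OF assms, of a] by (simp add: geometric_sum)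
  qed
  finally show ?thesis .
qed

text \<open>
  The map \<open>j \<mapsto> (i - j) mod n\<close> is an involution of the residues \<open>{..<n}\<close>.
\<close>

lemma sum_periodic_reflect:
  fixes g :: "int \<Rightarrow> 'a :: comm_monoid_add"
  assumes "n > 0" and "\<And>t. g (t mod int n) = g t"
  shows "(\<Sum>j<n. g (i - int j)) = (\<Sum>t<n. g (int t))"
proof (rule sum.reindex_bij_witness)
  let ?h = "\<lambda>j. nat ((i - int j) mod int n)"
  have h: "?h (?h j) = j" "?h j \<in> {..<n}" if "j \<in> {..<n}" for j
    using that assms(1) by (auto simp: mod_diff_right_eq nat_less_iff)
  show "?h (?h j) = j" "?h j \<in> {..<n}" if "j \<in> {..<n}" for j using h[OF that] by auto
  show "?h (?h j) = j" "?h j \<in> {..<n}" if "j \<in> {..<n}" for j using h[OF that] by auto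
  show "g (int (?h j)) = g (i - int j)" if "j \<in> {..<n}" for j
    using assms by simp
qed

text \<open>
  The columns of the Fourier matrix \<open>P\<close> are the characters of \<open>\<int>/n\<int>\<close>, and convolution with \<open>f\<close> multiplies each
  character by a Fourier coefficient of \<open>f\<close>.  By orthogonality of characters, \<open>P\<close> is invertible with inverse \<open>Q\<close>.
\<close>

lemma circulant_similar_diag:
  fixes f :: "int \<Rightarrow> complex"
  assumes n: "n > 0" and per: "\<And>t. f (t mod int n) = f t"
  shows "similar_mat (mat n n (\<lambda>(i, j). f (int i - int j)))
           (mat_diag n (\<lambda>k. \<Sum>t<n. f (int t) * unity_root n (- int t * int k)))"
proof -
  define A where "A = mat n n (\<lambda>(i, j). f (int i - int j))"
  define ev where "ev = (\<lambda>k. \<Sum>t<n. f (int t) * unity_root n (- int t * int k))"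
  define P where "P = mat n n (\<lambda>(i, k). unity_root n (int i * int k))"
  define Q where "Q = mat n n (\<lambda>(k, j). unity_root n (- int k * int j) / of_nat n)"
  have carrier: "A \<in> carrier_mat n n" "P \<in> carrier_mat n n" "Q \<in> carrier_mat n n"
    by (auto simp: A_def P_def Q_def)
  have orth: "(\<Sum>k<n. unity_root n (int i * int k) * (unity_root n (- int k * int j) / of_nat n)) =
      of_bool (i = j)" if "i < n" "j < n" for i j
  proof -
    have "(\<Sum>k<n. unity_root n (int i * int k) * (unity_root n (- int k * int j) / of_nat n)) =
        (\<Sum>k<n. unity_root n ((int i - int j) * int k)) / of_nat n"
      by (simp add: sum_divide_distrib unity_root_add[symmetric] algebra_simps)
    also have "\<dots> = of_bool (int n dvd int i - int j)"
      unfolding sum_unity_root[OF n] using n by simp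
    also have "int n dvd int i - int j \<longleftrightarrow> i = j"
      using that by (metis mod_eq_dvd_iff int_ops(9) mod_less of_nat_eq_iff)
    finally show ?thesis .
  qed
  have PQ: "P * Q = 1\<^sub>m n"
    by (rule eq_matI)
       (use orth in \<open>auto simp: P_def Q_def scalar_prod_def atLeast0LessThan of_bool_def\<close>)
  have QP: "Q * P = 1\<^sub>m n"
    using mat_mult_left_right_inverse[OF carrier(2,3) PQ] .
  have AP: "A * P = P * mat_diag n ev"
  proof (rule eq_matI)
    fix i k assume "i < dim_row (P * mat_diag n ev)" "k < dim_col (P * mat_diag n ev)"
    hence ik: "i < n" "k < n" by (auto simp: P_def mat_diag_def)
    define g where "g = (\<lambda>t. f t * unity_root n ((int i - t) * int k))"
    have "g (t mod int n) = g t" for t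
    proof -
      have "unity_root n ((int i - t mod int n) * int k) = unity_root n ((int i - t) * int k)"
        using unity_root_mod[OF n] by (metis mod_diff_right_eq mod_mult_left_eq)
      thus ?thesis by (simp add: g_def per)
    qed
    from sum_periodic_reflect[where g = g and i = "int i", OF n this]
    have "(\<Sum>j<n. f (int i - int j) * unity_root n (int j * int k)) =
        (\<Sum>t<n. f (int t) * unity_root n ((int i - int t) * int k))"
      by (simp add: g_def)
    also have "\<dots> = unity_root n (int i * int k) * ev k"
      by (simp add: ev_def sum_distrib_left unity_root_add[symmetric] algebra_simps)
    finally show "(A * P) $$ (i, k) = (P * mat_diag n ev) $$ (i, k)"
      using ik unfolding mat_diag_mult_right[OF carrier(2)]
      by (simp add: A_def P_def scalar_prod_def atLeast0LessThan)
  qed (auto simp: A_def P_def mat_diag_def)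
  have "A = A * (P * Q)" using carrier by (simp add: PQ)
  also have "\<dots> = P * mat_diag n ev * Q"
    using carrier by (simp add: assoc_mult_mat[of A n n P n Q n, symmetric] AP)
  finally show ?thesis
    unfolding A_def[symmetric] ev_def[symmetric] using carrier PQ QP
    by (intro similar_matI[of _ _ P Q n]) auto
qed

lemma char_poly_circulant:
  fixes f :: "int \<Rightarrow> complex"
  assumes "n > 0" and "\<And>t. f (t mod int n) = f t"
  shows "char_poly (mat n n (\<lambda>(i, j). f (int i - int j))) =
           (\<Prod>k<n. [:- (\<Sum>t<n. f (int t) * unity_root n (- int t * int k)), 1:])"
proof -
  define ev where "ev = (\<lambda>k. \<Sum>t<n. f (int t) * unity_root n (- int t * int k))"
  have "char_poly (mat n n (\<lambda>(i, j). f (int i - int j))) = char_poly (mat_diag n ev)"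
    unfolding ev_def using circulant_similar_diag[where f = f, OF assms] by (rule char_poly_similar)
  also have "\<dots> = (\<Prod>a\<leftarrow>diag_mat (mat_diag n ev). [:- a, 1:])"
    by (rule char_poly_upper_triangular[of _ n]) (auto simp: mat_diag_def)
  also have "diag_mat (mat_diag n ev) = map ev [0..<n]"
    by (auto simp: diag_mat_def mat_diag_def)
  also have "(\<Prod>a\<leftarrow>map ev [0..<n]. [:- a, 1:]) = (\<Prod>k<n. [:- ev k, 1:])"
    by (simp add: o_def prod.distinct_set_conv_list[symmetric] atLeast0LessThan)
  finally show ?thesis by (simp add: ev_def)
qed

text \<open>
  The order of a root \<open>x\<close> is the number of indices \<open>k\<close> with \<open>ev k = x\<close>, so the sum over distinct
  eigenvalues weighted by their order regroups into a sum over the linear factors.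
\<close>

lemma graph_energy_eq_sum:
  fixes ev :: "nat \<Rightarrow> complex"
  assumes "char_poly (adjacency_mat n E) = (\<Prod>k<m. [:- ev k, 1:])"
  shows "graph_energy n E = (\<Sum>k<m. cmod (ev k))"
proof -
  let ?p = "\<Prod>k<m. [:- ev k, 1:]"
  have nz: "?p \<noteq> 0" by simp
  have ord: "order x ?p = card {k. k < m \<and> ev k = x}" for x
  proof -
    have "order x ?p = count (proots ?p) x" by (rule count_proots[OF nz, symmetric])
    also have "proots ?p = (\<Sum>k<m. {#ev k#})" by (subst proots_prod) auto
    also have "count \<dots> x = card {k. k < m \<and> ev k = x}"
      by (simp add: count_sum sum.If_cases Int_def)
    finally show ?thesis .
  qed
  have eig: "{x. eigenvalue (adjacency_mat n E) x} = ev ` {..<m}"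
    by (auto simp: eigenvalue_root_char_poly[of _ n] adjacency_mat_def assms[unfolded adjacency_mat_def] poly_prod)
  have "(\<Sum>k<m. cmod (ev k)) = (\<Sum>x\<in>ev ` {..<m}. \<Sum>k\<in>{k \<in> {..<m}. ev k = x}. cmod (ev k))"
    by (rule sum.image_gen) simp
  also have "\<dots> = (\<Sum>x\<in>ev ` {..<m}. real (order x ?p) * cmod x)"
    by (rule sum.cong) (auto simp: ord)
  finally show ?thesis unfolding graph_energy_def eig assms by simp
qed

lemma adjacency_mat_icg:
  "adjacency_mat n (icg_edges n D) =
     mat n n (\<lambda>(i, j). of_bool (gcd (int i - int j) (int n) \<in> int ` D))"
proof -
  have "{i, j} \<in> icg_edges n D \<longleftrightarrow> gcd (int i - int j) (int n) \<in> int ` D" if "i < n" "j < n" for i j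
  proof -
    have "gcd (int j - int i) (int n) = gcd (int i - int j) (int n)"
      by (metis gcd_neg1 minus_diff_eq)
    hence "gcd (int a - int b) (int n) = gcd (int i - int j) (int n)"
      if "{i, j} = {a, b}" for a b
      using that unfolding doubleton_eq_iff by (elim disjE) simp_all
    thus ?thesis using that unfolding icg_edges_def by (smt (verit) mem_Collect_eq)
  qed
  thus ?thesis unfolding adjacency_mat_def by (intro cong_mat) auto
qed

lemma icg_energy_eq_sum:
  assumes "n > 0"
  shows "icg_energy n D =
    (\<Sum>k<n. cmod (\<Sum>t<n. of_bool (gcd t n \<in> D) * unity_root n (- int t * int k)))"
proof -
  let ?f = "\<lambda>t. of_bool (gcd t (int n) \<in> int ` D) :: complex"
  have "char_poly (adjacency_mat n (icg_edges n D)) =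
      (\<Prod>k<n. [:- (\<Sum>t<n. ?f (int t) * unity_root n (- int t * int k)), 1:])"
    unfolding adjacency_mat_icg by (rule char_poly_circulant[OF assms]) (metis gcd.commute gcd_red_int)
  from graph_energy_eq_sum[OF this] show ?thesis
    by (simp add: icg_energy_def gcd_int_int_eq image_iff del: of_bool_eq_iff)
qed

section \<open>The energy for prime powers\<close>

lemma sum_multiples:
  fixes g :: "nat \<Rightarrow> 'a :: semiring_1"
  assumes "d > 0"
  shows "(\<Sum>t<d * e. of_bool (d dvd t) * g t) = (\<Sum>j<e. g (d * j))"
proof -
  have "(\<Sum>t<d * e. of_bool (d dvd t) * g t) = sum g ({..<d * e} \<inter> {t. d dvd t})"
    by simp
  also have "{..<d * e} \<inter> {t. d dvd t} = (*) d ` {..<e}"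
    using assms by (auto elim!: dvdE)
  also have "sum g \<dots> = (\<Sum>j<e. g (d * j))"
    using assms by (subst sum.reindex) (auto simp: inj_on_def)
  finally show ?thesis .
qed

text \<open>
  This splits the indicator of the edge condition into a difference of two divisibility indicators,
  whose Fourier sums are geometric.
\<close>

lemma gcd_prime_power_eq_iff:
  fixes p t :: nat
  assumes "prime p" "a < s"
  shows "gcd t (p ^ s) = p ^ a \<longleftrightarrow> p ^ a dvd t \<and> \<not> p ^ Suc a dvd t"
proof -
  obtain b where b: "b \<le> s" "gcd t (p ^ s) = p ^ b"
    using divides_primepow_nat[OF assms(1), of "gcd t (p ^ s)" s] by auto
  have p: "p > 1" using assms(1) by (rule prime_gt_1_nat)
  have dvd: "p ^ c dvd t \<longleftrightarrow> c \<le> b" if "c \<le> s" for c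
  proof -
    have "p ^ c dvd t \<longleftrightarrow> p ^ c dvd gcd t (p ^ s)"
      using that by (simp add: le_imp_power_dvd)
    also have "\<dots> \<longleftrightarrow> c \<le> b" unfolding b(2) using p by (simp add: power_dvd_imp_le dvd_power_iff_le)
    finally show ?thesis .
  qed
  show ?thesis using dvd[of a] dvd[of "Suc a"] assms(2) p b(2) by auto
qed

text \<open>
  The summand for \<open>a\<close> is the Ramanujan sum of \<open>k\<close> to the modulus \<open>p ^ (s - a)\<close>.
\<close>

definition icg_eigenvalue :: "nat \<Rightarrow> nat \<Rightarrow> nat set \<Rightarrow> nat \<Rightarrow> real" where
  "icg_eigenvalue p s A k =
     (\<Sum>a\<in>A. real p ^ (s - a) * of_bool (p ^ (s - a) dvd k) -
             real p ^ (s - Suc a) * of_bool (p ^ (s - Suc a) dvd k))"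

lemma icg_fourier_prime_power:
  assumes p: "prime p" and A: "A \<subseteq> {..<s}"
  shows "(\<Sum>t<p ^ s. of_bool (gcd t (p ^ s) \<in> (\<lambda>a. p ^ a) ` A) * unity_root (p ^ s) (- int t * int k)) =
           of_real (icg_eigenvalue p s A k)"
proof -
  have p1: "p > 1" using p by (rule prime_gt_1_nat)
  let ?w = "\<lambda>t. unity_root (p ^ s) (- int t * int k)"
  have fin: "finite A" using A finite_subset by blast
  have ind: "(of_bool (gcd t (p ^ s) \<in> (\<lambda>a. p ^ a) ` A) :: complex) =
      (\<Sum>a\<in>A. of_bool (p ^ a dvd t) - of_bool (p ^ Suc a dvd t))" for t
  proof -
    have "(\<Sum>a\<in>A. of_bool (p ^ a dvd t) - of_bool (p ^ Suc a dvd t)) =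
        (\<Sum>a\<in>A. of_bool (gcd t (p ^ s) = p ^ a) :: complex)"
    proof (rule sum.cong[OF refl])
      fix a assume "a \<in> A"
      hence "a < s" using A by auto
      have "p ^ a dvd t" if "p ^ Suc a dvd t" using that by (metis power_Suc dvd_mult_right)
      thus "of_bool (p ^ a dvd t) - of_bool (p ^ Suc a dvd t) = (of_bool (gcd t (p ^ s) = p ^ a) :: complex)"
        unfolding gcd_prime_power_eq_iff[OF p \<open>a < s\<close>] by auto
    qed
    also have "\<dots> = of_bool (gcd t (p ^ s) \<in> (\<lambda>a. p ^ a) ` A)"
    proof (cases "gcd t (p ^ s) \<in> (\<lambda>a. p ^ a) ` A")
      case True
      then obtain b where "b \<in> A" "gcd t (p ^ s) = p ^ b" by auto
      thus ?thesis using p1 fin by (auto simp: of_bool_def)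
    next
      case False
      thus ?thesis by (auto intro!: sum.neutral)
    qed
    finally show ?thesis ..
  qed
  have part: "(\<Sum>t<p ^ s. of_bool (p ^ c dvd t) * ?w t) =
      of_real (real p ^ (s - c) * of_bool (p ^ (s - c) dvd k))" if "c \<le> s" for c
  proof -
    have ps: "p ^ s = p ^ c * p ^ (s - c)" using that by (simp add: power_add[symmetric])
    have pos: "p ^ c > 0" "p ^ (s - c) > 0" using p1 by auto
    have "(\<Sum>t<p ^ s. of_bool (p ^ c dvd t) * ?w t) = (\<Sum>j<p ^ (s - c). ?w (p ^ c * j))"
      by (subst ps) (rule sum_multiples[OF pos(1)])
    also have "\<dots> = (\<Sum>j<p ^ (s - c). unity_root (p ^ (s - c)) (- int k * int j))"
    proof (rule sum.cong[OF refl])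
      fix j
      show "?w (p ^ c * j) = unity_root (p ^ (s - c)) (- int k * int j)"
        using unity_root_cancel[OF pos(1), of "p ^ (s - c)" "- int k * int j"]
        by (simp add: ps mult_ac)
    qed
    also have "\<dots> = of_real (real p ^ (s - c) * of_bool (p ^ (s - c) dvd k))"
      unfolding sum_unity_root[OF pos(2)] by (simp del: of_nat_power add: of_nat_power[symmetric])
    finally show ?thesis .
  qed
  have "(\<Sum>t<p ^ s. of_bool (gcd t (p ^ s) \<in> (\<lambda>a. p ^ a) ` A) * ?w t) =
      (\<Sum>a\<in>A. (\<Sum>t<p ^ s. of_bool (p ^ a dvd t) * ?w t) - (\<Sum>t<p ^ s. of_bool (p ^ Suc a dvd t) * ?w t))"
    unfolding ind sum_distrib_right sum_subtractf[symmetric] left_diff_distrib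
    by (rule sum.swap)
  also have "\<dots> = of_real (icg_eigenvalue p s A k)"
    unfolding icg_eigenvalue_def of_real_sum
  proof (rule sum.cong[OF refl])
    fix a assume "a \<in> A"
    hence "a \<le> s" "Suc a \<le> s" using A by auto
    thus "(\<Sum>t<p ^ s. of_bool (p ^ a dvd t) * ?w t) - (\<Sum>t<p ^ s. of_bool (p ^ Suc a dvd t) * ?w t) =
        of_real (real p ^ (s - a) * of_bool (p ^ (s - a) dvd k) -
          real p ^ (s - Suc a) * of_bool (p ^ (s - Suc a) dvd k))"
      unfolding of_real_diff by (simp only: part)
  qed
  finally show ?thesis .
qed

lemma icg_energy_prime_power_eigenvalues:
  assumes "prime p" "A \<subseteq> {..<s}"
  shows "icg_energy (p ^ s) ((\<lambda>a. p ^ a) ` A) = (\<Sum>k<p ^ s. \<bar>icg_eigenvalue p s A k\<bar>)"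
  using icg_energy_eq_sum[of "p ^ s"] icg_fourier_prime_power[OF assms] prime_gt_0_nat[OF assms(1)]
  by simp

text \<open>
  If \<open>b \<in> A\<close> and \<open>p ^ (s - Suc b)\<close> is the exact power of \<open>p\<close> dividing \<open>k\<close>, then the Ramanujan sums for
  \<open>a < b\<close> vanish, the one for \<open>b\<close> is negative and those for \<open>a > b\<close> are positive; the quantity below is minus the
  resulting eigenvalue.
\<close>

definition neg_eigenvalue_depth :: "nat \<Rightarrow> nat \<Rightarrow> nat set \<Rightarrow> nat \<Rightarrow> real" where
  "neg_eigenvalue_depth p s A b =
     real p ^ (s - Suc b) - (\<Sum>a\<in>{a \<in> A. b < a}. real p ^ (s - a) - real p ^ (s - Suc a))"

text \<open>
  Enlarging the set of subtracted terms to all of \<open>{Suc b..<s}\<close> gives a telescoping sum with value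
  \<open>p ^ (s - Suc b) - 1\<close>.
\<close>

lemma neg_eigenvalue_depth_nonneg:
  assumes p: "p > 1" and A: "A \<subseteq> {..<s}" and b: "b < s"
  shows "neg_eigenvalue_depth p s A b \<ge> 0"
proof -
  have "(\<Sum>a\<in>{a \<in> A. b < a}. real p ^ (s - a) - real p ^ (s - Suc a)) \<le>
      (\<Sum>a\<in>{Suc b..<s}. real p ^ (s - a) - real p ^ (s - Suc a))"
    using A p by (intro sum_mono2) (auto intro!: power_increasing)
  also have "\<dots> = real p ^ (s - Suc b) - 1"
    using sum_Suc_diff'[of "Suc b" s "\<lambda>a. - (real p ^ (s - a))"] b by simp
  finally show ?thesis by (simp add: neg_eigenvalue_depth_def)
qed

text \<open>
  The sum on the right is the negative part of the eigenvalue: the bracket in each summand is the indicator of \<open>p ^ (s - Suc b)\<close>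
  being the exact power of \<open>p\<close> that divides \<open>k\<close>, which happens for at most one \<open>b\<close>.  If it happens for no \<open>b \<in> A\<close>, then
  every Ramanujan sum occurring in the eigenvalue is nonnegative.
\<close>

lemma abs_icg_eigenvalue:
  assumes p: "p > 1" and A: "A \<subseteq> {..<s}"
  shows "\<bar>icg_eigenvalue p s A k\<bar> = icg_eigenvalue p s A k +
     2 * (\<Sum>b\<in>A. (of_bool (p ^ (s - Suc b) dvd k) - of_bool (p ^ (s - b) dvd k)) *
            neg_eigenvalue_depth p s A b)"
proof -
  have fin: "finite A" using A finite_subset by blast
  have dvd_mono: "p ^ c dvd k" if "p ^ d dvd k" "c \<le> d" for c d
    using that by (meson dvd_trans le_imp_power_dvd)
  show ?thesis
  proof (cases "\<exists>b\<in>A. p ^ (s - Suc b) dvd k \<and> \<not> p ^ (s - b) dvd k")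
    case True
    then obtain b where b: "b \<in> A" "p ^ (s - Suc b) dvd k" "\<not> p ^ (s - b) dvd k" by blast
    have above: "p ^ (s - a) dvd k" "p ^ (s - Suc a) dvd k" if "b < a" for a
      using that by (auto intro!: dvd_mono[OF b(2)])
    have below: "\<not> p ^ (s - a) dvd k" "\<not> p ^ (s - Suc a) dvd k" if "a < b" for a
      using that b(3) dvd_mono[of _ "s - b"] by (meson Suc_leI diff_le_mono2 less_imp_le)+
    have "icg_eigenvalue p s A k = (\<Sum>a\<in>A.
        (if b < a then real p ^ (s - a) - real p ^ (s - Suc a) else 0) -
        (if a = b then real p ^ (s - Suc b) else 0))"
      unfolding icg_eigenvalue_def
    proof (rule sum.cong[OF refl])
      fix a assume "a \<in> A"
      show "real p ^ (s - a) * of_bool (p ^ (s - a) dvd k) -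
          real p ^ (s - Suc a) * of_bool (p ^ (s - Suc a) dvd k) =
          (if b < a then real p ^ (s - a) - real p ^ (s - Suc a) else 0) -
          (if a = b then real p ^ (s - Suc b) else 0)"
        using above[of a] below[of a] b by (cases a b rule: linorder_cases) auto
    qed
    also have "\<dots> = - neg_eigenvalue_depth p s A b"
      using fin b(1) unfolding neg_eigenvalue_depth_def sum.inter_filter[OF fin]
      by (subst sum_subtractf) simp
    finally have ev: "icg_eigenvalue p s A k = - neg_eigenvalue_depth p s A b" .
    have "(\<Sum>a\<in>A. (of_bool (p ^ (s - Suc a) dvd k) - of_bool (p ^ (s - a) dvd k)) *
        neg_eigenvalue_depth p s A a) = (\<Sum>a\<in>A. if a = b then neg_eigenvalue_depth p s A b else 0)"
    proof (rule sum.cong[OF refl])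
      fix a assume "a \<in> A"
      show "(of_bool (p ^ (s - Suc a) dvd k) - of_bool (p ^ (s - a) dvd k)) *
          neg_eigenvalue_depth p s A a = (if a = b then neg_eigenvalue_depth p s A b else 0)"
        using above[of a] below[of a] b by (cases a b rule: linorder_cases) auto
    qed
    also have "\<dots> = neg_eigenvalue_depth p s A b" using fin b(1) by simp
    finally show ?thesis
      using neg_eigenvalue_depth_nonneg[OF p A, of b] b(1) A ev by auto
  next
    case False
    hence eq: "p ^ (s - Suc a) dvd k \<longleftrightarrow> p ^ (s - a) dvd k" if "a \<in> A" for a
      using that dvd_mono[of "s - a" "s - Suc a"] by (meson diff_le_mono2 lessI less_imp_le)
    have "icg_eigenvalue p s A k \<ge> 0" unfolding icg_eigenvalue_def
    proof (rule sum_nonneg)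
      fix a assume a: "a \<in> A"
      have "real p ^ (s - Suc a) \<le> real p ^ (s - a)" using p by (intro power_increasing) auto
      thus "0 \<le> real p ^ (s - a) * of_bool (p ^ (s - a) dvd k) -
          real p ^ (s - Suc a) * of_bool (p ^ (s - Suc a) dvd k)"
        by (simp add: eq[OF a])
    qed
    moreover have "(\<Sum>b\<in>A. (of_bool (p ^ (s - Suc b) dvd k) - of_bool (p ^ (s - b) dvd k)) *
            neg_eigenvalue_depth p s A b) = 0"
      by (rule sum.neutral) (simp add: eq)
    ultimately show ?thesis by simp
  qed
qed

lemma sum_of_bool_power_dvd:
  assumes "p > 1" "c \<le> s"
  shows "(\<Sum>k<p ^ s. of_bool (p ^ c dvd k) :: real) = real p ^ (s - c)"
proof -
  have "p ^ s = p ^ c * p ^ (s - c)" using assms by (simp add: power_add[symmetric])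
  thus ?thesis using sum_multiples[of "p ^ c" "\<lambda>_. 1 :: real" "p ^ (s - c)"] assms
    by (simp del: sum_of_bool_eq sum_mult_of_bool_eq sum_of_bool_mult_eq)
qed

text \<open>
  This is the vanishing trace of the adjacency matrix.
\<close>

lemma sum_icg_eigenvalue:
  assumes p: "p > 1" and A: "A \<subseteq> {..<s}"
  shows "(\<Sum>k<p ^ s. icg_eigenvalue p s A k) = 0"
proof -
  have *: "(\<Sum>k<p ^ s. real p ^ c * of_bool (p ^ c dvd k)) = real p ^ s" if "c \<le> s" for c
    using that unfolding sum_distrib_left[symmetric] sum_of_bool_power_dvd[OF p that]
    by (simp add: power_add[symmetric])
  have "(\<Sum>k<p ^ s. icg_eigenvalue p s A k) =
      (\<Sum>a\<in>A. (\<Sum>k<p ^ s. real p ^ (s - a) * of_bool (p ^ (s - a) dvd k)) -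
             (\<Sum>k<p ^ s. real p ^ (s - Suc a) * of_bool (p ^ (s - Suc a) dvd k)))"
    unfolding icg_eigenvalue_def sum_subtractf[symmetric] by (rule sum.swap)
  thus ?thesis by (simp only: * diff_le_self) simp
qed

text \<open>
  As the eigenvalues sum to \<open>0\<close>, the energy is twice the total negative part.  Exactly
  \<open>p ^ Suc b - p ^ b\<close> of the residues modulo \<open>p ^ s\<close> are divisible by \<open>p ^ (s - Suc b)\<close> but not by \<open>p ^ (s - b)\<close>, and all of
  them share one eigenvalue.
\<close>

lemma icg_energy_prime_power:
  assumes prime: "prime p" and A: "A \<subseteq> {..<s}"
  shows "icg_energy (p ^ s) ((\<lambda>a. p ^ a) ` A) = 2 * (real p - 1) * real p ^ (s - 1) *
    (\<Sum>b\<in>A. 1 - (1 - 1 / p) * (\<Sum>a\<in>{a \<in> A. b < a}. (1 / p) ^ (a - Suc b)))"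
proof -
  have p: "p > 1" using prime by (rule prime_gt_1_nat)
  have "icg_energy (p ^ s) ((\<lambda>a. p ^ a) ` A) =
      2 * (\<Sum>k<p ^ s. \<Sum>b\<in>A. (of_bool (p ^ (s - Suc b) dvd k) - of_bool (p ^ (s - b) dvd k)) *
         neg_eigenvalue_depth p s A b)"
    unfolding icg_energy_prime_power_eigenvalues[OF assms] abs_icg_eigenvalue[OF p A] sum.distrib
      sum_icg_eigenvalue[OF p A] sum_distrib_left[symmetric] by simp
  also have "\<dots> = 2 * (\<Sum>b\<in>A. ((\<Sum>k<p ^ s. of_bool (p ^ (s - Suc b) dvd k)) -
      (\<Sum>k<p ^ s. of_bool (p ^ (s - b) dvd k))) * neg_eigenvalue_depth p s A b)"
    unfolding sum_subtractf[symmetric] sum_distrib_right by (subst sum.swap) (rule refl)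
  also have "\<dots> = 2 * (\<Sum>b\<in>A. (real p ^ Suc b - real p ^ b) * neg_eigenvalue_depth p s A b)"
  proof (intro arg_cong[where f = "(*) 2"] sum.cong[OF refl])
    fix b assume "b \<in> A"
    hence "s - (s - Suc b) = Suc b" "s - (s - b) = b" using A by auto
    thus "((\<Sum>k<p ^ s. of_bool (p ^ (s - Suc b) dvd k)) -
        (\<Sum>k<p ^ s. of_bool (p ^ (s - b) dvd k))) * neg_eigenvalue_depth p s A b =
        (real p ^ Suc b - real p ^ b) * neg_eigenvalue_depth p s A b"
      by (simp only: sum_of_bool_power_dvd[OF p] diff_le_self)
  qed
  also have "\<dots> = 2 * (\<Sum>b\<in>A. (real p - 1) * real p ^ (s - 1) *
      (1 - (1 - 1 / p) * (\<Sum>a\<in>{a \<in> A. b < a}. (1 / p) ^ (a - Suc b))))"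
  proof (intro arg_cong[where f = "(*) 2"] sum.cong[OF refl])
    fix b assume "b \<in> A"
    hence b: "b < s" using A by auto
    have split: "real p ^ (s - 1) = real p ^ b * real p ^ (s - Suc b)"
      using b by (simp add: power_add[symmetric])
    have "real p ^ b * (real p ^ (s - a) - real p ^ (s - Suc a)) =
        real p ^ (s - 1) * ((1 - 1 / p) * (1 / p) ^ (a - Suc b))" if "a \<in> A" "b < a" for a
    proof -
      have "a < s" using that A by auto
      define c d where "c = a - Suc b" and "d = s - Suc a"
      have c: "a = Suc (b + c)" and d: "s = Suc (a + d)"
        using \<open>a < s\<close> that by (simp_all add: c_def d_def)
      show ?thesis using p by (simp add: c d power_add field_simps)
    qed
    hence "real p ^ b * (\<Sum>a\<in>{a \<in> A. b < a}. real p ^ (s - a) - real p ^ (s - Suc a)) =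
        real p ^ (s - 1) * ((1 - 1 / p) * (\<Sum>a\<in>{a \<in> A. b < a}. (1 / p) ^ (a - Suc b)))"
      unfolding sum_distrib_left by (intro sum.cong) auto
    hence "real p ^ b * neg_eigenvalue_depth p s A b = real p ^ (s - 1) *
        (1 - (1 - 1 / p) * (\<Sum>a\<in>{a \<in> A. b < a}. (1 / p) ^ (a - Suc b)))"
      unfolding neg_eigenvalue_depth_def right_diff_distrib by (simp only: split mult_1_right)
    moreover have "real p ^ Suc b - real p ^ b = (real p - 1) * real p ^ b"
      by (simp add: algebra_simps)
    ultimately show "(real p ^ Suc b - real p ^ b) * neg_eigenvalue_depth p s A b =
        (real p - 1) * real p ^ (s - 1) *
        (1 - (1 - 1 / p) * (\<Sum>a\<in>{a \<in> A. b < a}. (1 / p) ^ (a - Suc b)))"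
      by (simp only: mult.assoc)
  qed
  finally show ?thesis by (simp only: sum_distrib_left[symmetric] mult.assoc)
qed

section \<open>The energy as the gain of a word\<close>

text \<open>
  The letters of a word tell which exponents are chosen.  The second argument is the penalty which
  the letters already read impose on the next exponent: a choice made \<open>d\<close> letters earlier contributes
  \<open>(1 - q) * q ^ (d - 1)\<close>, so the penalty shrinks by the factor \<open>q\<close> with every letter and grows by \<open>1 - q\<close> with every
  choice.
\<close>

fun gain :: "real \<Rightarrow> real \<Rightarrow> bool list \<Rightarrow> real" where
  "gain q x [] = 0"
| "gain q x (b # w) =
     (if b then 1 - x + gain q (q * x + (1 - q)) w else gain q (q * x) w)"

text \<open>
  Unfolding the recursion, the letter at position \<open>b\<close> pays \<open>q ^ b * x\<close> for the initial penalty and one term for each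
  chosen position before it.
\<close>

lemma gain_map_upt:
  "gain q x (map f [0..<n]) =
     (\<Sum>b<n. of_bool (f b) * (1 - q ^ b * x - (1 - q) * (\<Sum>a<b. of_bool (f a) * q ^ (b - Suc a))))"
proof (induction n arbitrary: f x)
  case (Suc n)
  define x' where "x' = q * x + (1 - q) * of_bool (f 0)"
  have "gain q x (map f [0..<Suc n]) =
      of_bool (f 0) * (1 - x) + gain q x' (map (\<lambda>i. f (Suc i)) [0..<n])"
    unfolding map_upt_Suc by (simp add: x'_def)
  also have "gain q x' (map (\<lambda>i. f (Suc i)) [0..<n]) = (\<Sum>b<n. of_bool (f (Suc b)) *
      (1 - q ^ Suc b * x - (1 - q) * (\<Sum>a<Suc b. of_bool (f a) * q ^ (Suc b - Suc a))))"
    unfolding Suc.IH sum.lessThan_Suc_shift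
    by (intro sum.cong arg_cong2[where f = "(*)"] refl)
       (simp add: x'_def algebra_simps del: sum_of_bool_mult_eq sum_mult_of_bool_eq)
  finally show ?case
    unfolding sum.lessThan_Suc_shift[of _ n] by simp
qed simp

lemma gain_indicator_word:
  assumes "A \<subseteq> {..<s}"
  shows "gain q 0 (map (\<lambda>i. i \<in> A) [0..<s]) =
    (\<Sum>b\<in>A. 1 - (1 - q) * (\<Sum>a\<in>{a \<in> A. b < a}. q ^ (a - Suc b)))"
proof -
  have fin: "finite A" using assms finite_subset by blast
  have sets: "{..<s} \<inter> A = A" "{..<a} \<inter> A = {b \<in> A. b < a}" "{b \<in> A. b < s} = A" for a
    using assms by auto
  have "gain q 0 (map (\<lambda>i. i \<in> A) [0..<s]) =
      (\<Sum>a\<in>A. 1 - (1 - q) * (\<Sum>b\<in>{b \<in> A. b < a}. q ^ (a - Suc b)))"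
    unfolding gain_map_upt by (simp add: sets)
  also have "\<dots> = (\<Sum>b\<in>A. 1 - (1 - q) * (\<Sum>a\<in>{a \<in> A. b < a}. q ^ (a - Suc b)))"
    unfolding sum_subtractf sum_distrib_left[symmetric]
    by (subst sum.swap_restrict[OF fin fin]) (rule refl)
  finally show ?thesis .
qed

lemma icg_energy_eq_gain:
  assumes "prime p" "A \<subseteq> {..<s}"
  shows "icg_energy (p ^ s) ((\<lambda>a. p ^ a) ` A) =
    2 * (real p - 1) * real p ^ (s - 1) * gain (1 / p) 0 (map (\<lambda>i. i \<in> A) [0..<s])"
  using icg_energy_prime_power[OF assms] gain_indicator_word[OF assms(2)] by simp

section \<open>Words of maximal gain\<close>

definition optimal_words :: "real \<Rightarrow> real \<Rightarrow> nat \<Rightarrow> bool list set" where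
  "optimal_words q x n =
     {w. length w = n \<and> (\<forall>v. length v = n \<longrightarrow> gain q x v \<le> gain q x w)}"

lemma optimal_words_nonempty: "optimal_words q x n \<noteq> {}"
proof -
  have fin: "finite {w :: bool list. length w = n}"
    using finite_lists_length_eq[of "UNIV :: bool set" n] by simp
  have ne: "{w :: bool list. length w = n} \<noteq> {}"
    using Ex_list_of_length[of n] by blast
  show ?thesis
    using Max_in[of "gain q x ` {w. length w = n}"] Max_ge[of "gain q x ` {w. length w = n}"] fin ne
    unfolding optimal_words_def by fastforce
qed

text \<open>
  Optimal words repeat the pattern \<open>True, False\<close> up to a short tail \<open>t\<close>, which is \<open>[True]\<close> or \<open>[True, True]\<close> depending
  on the parity of the length, possibly after one extra initial letter.
\<close>

fun alternating :: "nat \<Rightarrow> bool list \<Rightarrow> bool list" where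
  "alternating 0 t = t"
| "alternating (Suc m) t = True # False # alternating m t"

lemma length_alternating [simp]: "length (alternating m t) = 2 * m + length t"
  by (induction m) auto

lemma alternating_conv_map: "alternating m t = map even [0..<2 * m] @ t"
proof (induction m)
  case (Suc m)
  have "map even [0..<Suc (Suc (2 * m))] = True # False # map even [0..<2 * m]"
    unfolding map_upt_Suc by simp
  thus ?case using Suc by (simp del: upt_Suc)
qed simp

text \<open>
  The gain of a word is affine in the initial penalty; here are the coefficients for the two alternating words.
\<close>

lemma
  assumes "0 < q" "q < 1"
  shows gain_alternating_single:
    "gain q x (alternating m [True]) =
       (real m + 1 + q * (1 - q ^ (2 * m + 2)) / (1 - q\<^sup>2)) / (1 + q) -
       (1 - q ^ (2 * m + 2)) / (1 - q\<^sup>2) * x" (is ?A)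
    and gain_alternating_double:
    "gain q x (alternating m [True, True]) =
       gain q x (alternating m [True]) + (q + q ^ (2 * m + 2)) / (1 + q) -
       q ^ (2 * m + 1) * x" (is ?B)
proof -
  have [simp]: "1 + q \<noteq> 0" "1 - q \<noteq> 0" "q \<noteq> 1" "q \<noteq> -1" using assms by auto
  have sq: "1 - q\<^sup>2 = (1 - q) * (1 + q)"
    by (simp add: power2_eq_square algebra_simps)
  show ?A
  proof (induction m arbitrary: x)
    case 0
    show ?case unfolding sq by (simp add: divide_simps power2_eq_square) (simp add: algebra_simps)
  next
    case (Suc m)
    define z where "z = q ^ (2 * m)"
    have "q ^ (2 * m + 2) = q * q * z" "q ^ (2 * Suc m + 2) = q * q * q * q * z"
      by (simp_all add: z_def power_add algebra_simps)
    thus ?case unfolding alternating.simps gain.simps Suc sq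
      by (simp add: divide_simps power2_eq_square) (simp add: algebra_simps)
  qed
  show ?B
  proof (induction m arbitrary: x)
    case 0
    show ?case by (simp add: divide_simps power2_eq_square) (simp add: algebra_simps)
  next
    case (Suc m)
    define z where "z = q ^ (2 * m)"
    have "q ^ (2 * m + 2) = q * q * z" "q ^ (2 * Suc m + 2) = q * q * q * q * z"
      "q ^ (2 * m + 1) = q * z" "q ^ (2 * Suc m + 1) = q * q * q * z"
      by (simp_all add: z_def power_add algebra_simps)
    thus ?case unfolding alternating.simps gain.simps Suc
      by (simp add: divide_simps power2_eq_square) (simp add: algebra_simps)
  qed
qed

text \<open>
  For words of length \<open>2 * m + 2\<close> this shows that \<open>q\<close> is the penalty at which choosing and skipping the next exponent
  are equally good: the second factor is positive.
\<close>

lemma gain_even_diff: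
  assumes "0 < q" "q < 1"
  shows "gain q x (alternating m [True, True]) - gain q x (False # alternating m [True]) =
           (q - x) * ((1 + q ^ (2 * m + 1)) / (1 + q))"
proof -
  have [simp]: "1 + q \<noteq> 0" "1 - q \<noteq> 0" "q \<noteq> 1" "q \<noteq> -1" using assms by auto
  have sq: "1 - q\<^sup>2 = (1 - q) * (1 + q)"
    by (simp add: power2_eq_square algebra_simps)
  define z where "z = q ^ (2 * m)"
  have "q ^ (2 * m + 2) = q * q * z" "q ^ (2 * m + 1) = q * z"
    by (simp_all add: z_def power_add algebra_simps)
  thus ?thesis
    unfolding gain.simps gain_alternating_double[OF assms] gain_alternating_single[OF assms] sq
    by (simp add: divide_simps power2_eq_square) (simp add: algebra_simps)
qed

text \<open>
  For words of length \<open>2 * m + 3\<close> the break-even penalty is \<open>1 - q\<close>.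
\<close>

lemma gain_odd_diff:
  assumes "0 < q" "q < 1"
  shows "gain q x (alternating (Suc m) [True]) - gain q x (False # alternating m [True, True]) =
           (1 - q - x) * ((1 - q ^ (2 * m + 2)) / (1 + q))"
proof -
  have [simp]: "1 + q \<noteq> 0" "1 - q \<noteq> 0" "q \<noteq> 1" "q \<noteq> -1" using assms by auto
  have sq: "1 - q\<^sup>2 = (1 - q) * (1 + q)"
    by (simp add: power2_eq_square algebra_simps)
  define z where "z = q ^ (2 * m)"
  have "q ^ (2 * m + 2) = q * q * z" "q ^ (2 * m + 1) = q * z"
    "q ^ (2 * Suc m + 2) = q * q * q * q * z"
    by (simp_all add: z_def power_add algebra_simps)
  thus ?thesis
    unfolding gain.simps(2)[of q x False] gain_alternating_double[OF assms] gain_alternating_single[OF assms] sq if_False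
    by (simp add: divide_simps power2_eq_square) (simp add: algebra_simps)
qed

lemma sgn_gain_even_diff:
  assumes "0 < q" "q < 1"
  shows "sgn (gain q x (alternating m [True, True]) - gain q x (False # alternating m [True])) =
           sgn (q - x)"
proof -
  have "(1 + q ^ (2 * m + 1)) / (1 + q) > 0" using assms by (intro divide_pos_pos add_pos_pos) auto
  thus ?thesis unfolding gain_even_diff[OF assms] sgn_mult by (simp only: sgn_pos mult_1_right)
qed

lemma sgn_gain_odd_diff:
  assumes "0 < q" "q < 1"
  shows "sgn (gain q x (alternating (Suc m) [True]) - gain q x (False # alternating m [True, True])) =
           sgn (1 - q - x)"
proof -
  have "q ^ (2 * m + 2) < 1" using assms power_Suc_less_one[of q "2 * m + 1"] by simp
  hence "(1 - q ^ (2 * m + 2)) / (1 + q) > 0" using assms by (intro divide_pos_pos) auto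
  thus ?thesis unfolding gain_odd_diff[OF assms] sgn_mult by (simp only: sgn_pos mult_1_right)
qed

lemma penalty_after_choice:
  fixes q x :: real
  assumes "0 < q" "q < 1" "0 < x" "x < 1"
  shows "0 < q * x + (1 - q)" "q * x + (1 - q) < 1" "1 - q < q * x + (1 - q)"
proof -
  have "0 < q * x" "q * x < q" using assms by simp_all
  thus "0 < q * x + (1 - q)" "q * x + (1 - q) < 1" "1 - q < q * x + (1 - q)" using assms by linarith+
qed

lemma penalty_after_skip:
  fixes q x :: real
  assumes "0 < q" "q < 1" "0 < x" "x < 1"
  shows "0 < q * x" "q * x < 1" "q * x < q"
proof -
  have "0 < q * x" "q * x < q" using assms by simp_all
  thus "0 < q * x" "q * x < 1" "q * x < q" using assms by linarith+
qed

text \<open>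
  After a choice the penalty exceeds \<open>1 - q \<ge> q\<close>, after a skip it is below \<open>q\<close>.  In both cases the even-length
  comparison decides strictly which of its two candidates must follow, so that every first letter has a unique best
  continuation.
\<close>

lemma gain_less_candidates_odd_step:
  assumes q: "0 < q" "q \<le> 1 / 2" and x: "0 < x" "x < 1"
    and IH: "\<And>y v. \<lbrakk>0 < y; y < 1; length v = 2 * m + 2; v \<noteq> alternating m [True, True];
       v \<noteq> False # alternating m [True]\<rbrakk> \<Longrightarrow>
       gain q y v < max (gain q y (alternating m [True, True])) (gain q y (False # alternating m [True]))"
    and w: "length w = 2 * m + 3" "w \<noteq> alternating (Suc m) [True]"
       "w \<noteq> False # alternating m [True, True]"
  shows "gain q x w < max (gain q x (alternating (Suc m) [True])) (gain q x (False # alternating m [True, True]))"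
proof -
  have q1: "q < 1" using q by simp
  obtain b v where bv: "w = b # v" "length v = 2 * m + 2"
    using w(1) by (cases w) auto
  note d = sgn_gain_even_diff[OF q(1) q1, of _ m]
  show ?thesis
  proof (cases b)
    case True
    define y where "y = q * x + (1 - q)"
    have y: "0 < y" "y < 1" "1 - q < y" using penalty_after_choice[OF q(1) q1 x] by (auto simp: y_def)
    have "gain q y (alternating m [True, True]) < gain q y (False # alternating m [True])"
      using d[of y] y q by (auto simp: sgn_if split: if_splits)
    moreover have "v \<noteq> False # alternating m [True]" using w bv True by auto
    ultimately have "gain q y v < gain q y (False # alternating m [True])"
      using IH[OF y(1,2) bv(2)] by (cases "v = alternating m [True, True]") auto
    hence "gain q x w < gain q x (alternating (Suc m) [True])"
      using True by (simp add: bv y_def)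
    thus ?thesis by simp
  next
    case False
    define y where "y = q * x"
    have y: "0 < y" "y < 1" "y < q" using penalty_after_skip[OF q(1) q1 x] by (auto simp: y_def)
    have "gain q y (False # alternating m [True]) < gain q y (alternating m [True, True])"
      using d[of y] y q by (auto simp: sgn_if split: if_splits)
    moreover have "v \<noteq> alternating m [True, True]" using w bv False by auto
    ultimately have "gain q y v < gain q y (alternating m [True, True])"
      using IH[OF y(1,2) bv(2)] by (cases "v = False # alternating m [True]") auto
    hence "gain q x w < gain q x (False # alternating m [True, True])"
      using False by (simp add: bv y_def)
    thus ?thesis by simp
  qed
qed

text \<open>
  The induction alternates between the parities.  For odd length the break-even penalty is \<open>1 - q\<close>, and
  again a choice leads strictly above it, a skip strictly below it since \<open>q \<le> 1 - q\<close>.  The strict inequality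
  \<open>0 < x\<close> is what keeps the penalty after a choice off the break-even point.
\<close>

lemma gain_less_candidates_even:
  assumes q: "0 < q" "q \<le> 1 / 2" and x: "0 < x" "x < 1"
    and w: "length w = 2 * m + 2" "w \<noteq> alternating m [True, True]"
       "w \<noteq> False # alternating m [True]"
  shows "gain q x w < max (gain q x (alternating m [True, True])) (gain q x (False # alternating m [True]))"
  using x w
proof (induction m arbitrary: x w)
  case 0
  have q1: "q < 1" using q by simp
  obtain b c where "w = [b, c]"
    using 0(3) by (auto simp: length_Suc_conv numeral_2_eq_2)
  thus ?case using 0 penalty_after_choice[OF q(1) q1, of x] penalty_after_skip[OF q(1) q1, of x]
    by (cases b; cases c) auto
next
  case (Suc m)
  have q1: "q < 1" using q by simp
  obtain b v where bv: "w = b # v" "length v = 2 * m + 3"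
    using Suc.prems(3) by (cases w) auto
  note d = sgn_gain_odd_diff[OF q(1) q1, of _ m]
  note odd = gain_less_candidates_odd_step[OF q _ _ Suc.IH]
  show ?case
  proof (cases b)
    case True
    define y where "y = q * x + (1 - q)"
    have y: "0 < y" "y < 1" "1 - q < y" using penalty_after_choice[OF q(1) q1 Suc.prems(1,2)] by (auto simp: y_def)
    have "gain q y (alternating (Suc m) [True]) < gain q y (False # alternating m [True, True])"
      using d[of y] y q by (auto simp: sgn_if split: if_splits)
    moreover have "v \<noteq> False # alternating m [True, True]" using Suc.prems bv True by auto
    ultimately have "gain q y v < gain q y (False # alternating m [True, True])"
      using odd[OF y(1,2) _ _ _ _ _ bv(2)] by (cases "v = alternating (Suc m) [True]") auto
    hence "gain q x w < gain q x (alternating (Suc m) [True, True])"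
      using True by (simp add: bv y_def)
    thus ?thesis by simp
  next
    case False
    define y where "y = q * x"
    have y: "0 < y" "y < 1" "y < q" using penalty_after_skip[OF q(1) q1 Suc.prems(1,2)] by (auto simp: y_def)
    have "gain q y (False # alternating m [True, True]) < gain q y (alternating (Suc m) [True])"
      using d[of y] y q by (auto simp: sgn_if split: if_splits)
    moreover have "v \<noteq> alternating (Suc m) [True]" using Suc.prems bv False by auto
    ultimately have "gain q y v < gain q y (alternating (Suc m) [True])"
      using odd[OF y(1,2) _ _ _ _ _ bv(2)] by (cases "v = False # alternating m [True, True]") auto
    hence "gain q x w < gain q x (False # alternating (Suc m) [True])"
      using False by (simp add: bv y_def)
    thus ?thesis by simp
  qed
qed

lemma gain_less_candidates_odd:
  assumes "0 < q" "q \<le> 1 / 2" "0 < x" "x < 1"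
    and "length w = 2 * m + 3" "w \<noteq> alternating (Suc m) [True]"
       "w \<noteq> False # alternating m [True, True]"
  shows "gain q x w < max (gain q x (alternating (Suc m) [True])) (gain q x (False # alternating m [True, True]))"
  using assms gain_less_candidates_odd_step gain_less_candidates_even by metis

lemma optimal_words_two_candidates:
  assumes "length u = n" "length v = n"
    and "\<And>w. \<lbrakk>length w = n; w \<noteq> u; w \<noteq> v\<rbrakk> \<Longrightarrow> gain q x w < max (gain q x u) (gain q x v)"
  shows "gain q x u < gain q x v \<Longrightarrow> optimal_words q x n = {v}"
    and "gain q x u = gain q x v \<Longrightarrow> optimal_words q x n = {u, v}"
proof -
  show "optimal_words q x n = {v}" if "gain q x u < gain q x v"
    using assms that unfolding optimal_words_def by (force simp: not_le[symmetric])
  show "optimal_words q x n = {u, v}" if "gain q x u = gain q x v"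
    using assms that unfolding optimal_words_def by (force simp: not_le[symmetric])
qed

text \<open>
  The penalty stays below \<open>1\<close>, so one more choice at the end always pays.
\<close>

lemma gain_snoc_True:
  assumes "0 < q" "q < 1" "0 \<le> x" "x < 1"
  shows "gain q x w < gain q x (w @ [True])"
  using assms(3,4)
proof (induction w arbitrary: x)
  case (Cons b w)
  have "0 \<le> q * x" "q * x < q" using assms(1) Cons.prems by simp_all
  hence "0 \<le> q * x" "q * x < 1" "q * x + (1 - q) < 1" using assms(2) by linarith+
  moreover have "0 \<le> q * x + (1 - q)" using \<open>0 \<le> q * x\<close> assms(2) by linarith
  ultimately have "gain q (q * x) w < gain q (q * x) (w @ [True])"
    "gain q (q * x + (1 - q)) w < gain q (q * x + (1 - q)) (w @ [True])"
    by (blast intro: Cons.IH)+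
  thus ?case by simp
qed simp

text \<open>
  With penalty \<open>0\<close> an initial skip changes nothing; deleting it and appending a choice at the end improves the word.
  An optimal word therefore starts with a choice, after which the penalty is \<open>1 - q\<close>.
\<close>

lemma optimal_words_from_zero:
  assumes "0 < q" "q < 1"
  shows "optimal_words q 0 (Suc n) = (#) True ` optimal_words q (1 - q) n"
proof -
  have first: "hd w" if w: "w \<in> optimal_words q 0 (Suc n)" for w
  proof (rule ccontr)
    assume "\<not> hd w"
    then obtain v where v: "w = False # v" "length v = n"
      using w by (cases w) (auto simp: optimal_words_def)
    have "gain q 0 w < gain q 0 (v @ [True])" using gain_snoc_True[OF assms, of 0 v] v by simp
    moreover have "gain q 0 (v @ [True]) \<le> gain q 0 w"
      using w v(2) unfolding optimal_words_def by auto
    ultimately show False by simp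
  qed
  have sub: "\<exists>v. w = True # v \<and> v \<in> optimal_words q (1 - q) n"
    if w: "w \<in> optimal_words q 0 (Suc n)" for w
  proof -
    obtain v where v: "w = True # v" "length v = n"
      using w first[OF w] by (cases w) (auto simp: optimal_words_def)
    have "gain q (1 - q) u \<le> gain q (1 - q) v" if "length u = n" for u
    proof -
      have "gain q 0 (True # u) \<le> gain q 0 w"
        using w that by (auto simp: optimal_words_def simp del: gain.simps)
      thus ?thesis by (simp add: v)
    qed
    thus ?thesis using v by (auto simp: optimal_words_def)
  qed
  \<comment> \<open>All words in the image have equal gain, and at least one of them is optimal.\<close>
  obtain w0 where w0: "w0 \<in> optimal_words q 0 (Suc n)" using optimal_words_nonempty by blast
  then obtain v0 where v0: "w0 = True # v0" "v0 \<in> optimal_words q (1 - q) n" using sub by blast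
  have "True # v \<in> optimal_words q 0 (Suc n)" if v: "v \<in> optimal_words q (1 - q) n" for v
  proof -
    have "gain q (1 - q) v0 \<le> gain q (1 - q) v" using v v0 by (auto simp: optimal_words_def)
    hence "gain q 0 w0 \<le> gain q 0 (True # v)" by (simp add: v0)
    thus ?thesis using w0 v unfolding optimal_words_def by (auto simp del: gain.simps intro: order_trans)
  qed
  thus ?thesis using sub by blast
qed

lemma optimal_words_singleton_length:
  assumes "x < 1"
  shows "optimal_words q x 1 = {[True]}"
proof -
  have len: "length w = 1 \<longleftrightarrow> w = [True] \<or> w = [False]" for w
    by (cases w) auto
  have "optimal_words q x 1 =
      {w. (w = [True] \<or> w = [False]) \<and> gain q x [True] \<le> gain q x w \<and> gain q x [False] \<le> gain q x w}"
    unfolding optimal_words_def len by blast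
  also have "\<dots> = {[True]}" using assms by auto
  finally show ?thesis .
qed

text \<open>
  After the first choice an odd number of letters remains with penalty exactly at the break-even point \<open>1 - q\<close>.
  If this number is \<open>1\<close>, then there is no tie, but the two words below coincide.
\<close>

lemma optimal_words_even:
  assumes q: "0 < q" "q \<le> 1 / 2"
  shows "optimal_words q 0 (2 * m + 2) = {alternating m [True, True], True # alternating m [True]}"
proof (cases m)
  case 0
  thus ?thesis
    using q optimal_words_from_zero[of q 1] optimal_words_singleton_length[of "1 - q" q]
    by (simp add: numeral_2_eq_2)
next
  case (Suc k)
  have q1: "q < 1" using q by simp
  have "gain q (1 - q) (alternating (Suc k) [True]) = gain q (1 - q) (False # alternating k [True, True])"
    using sgn_gain_odd_diff[OF q(1) q1, of "1 - q" k] by (simp add: sgn_0_0 del: gain.simps alternating.simps)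
  hence "optimal_words q (1 - q) (2 * k + 3) =
      {alternating (Suc k) [True], False # alternating k [True, True]}"
    using q q1 by (intro optimal_words_two_candidates(2) gain_less_candidates_odd) simp_all
  moreover have "2 * m + 2 = Suc (2 * k + 3)" using Suc by simp
  ultimately show ?thesis
    using optimal_words_from_zero[OF q(1) q1, of "2 * k + 3"] Suc
    by (simp only: image_insert image_empty alternating.simps insert_commute)
qed

text \<open>
  After the first choice an even number of letters remains, and the penalty \<open>1 - q\<close> lies strictly above the
  break-even point \<open>q\<close>.
\<close>

lemma optimal_words_odd:
  assumes q: "0 < q" "q < 1 / 2"
  shows "optimal_words q 0 (2 * m + 1) = {alternating m [True]}"
proof (cases m)
  case 0
  have "optimal_words q (1 - q) 0 = {[]}" by (auto simp: optimal_words_def)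
  thus ?thesis using optimal_words_from_zero[of q 0] q by (simp add: 0)
next
  case (Suc k)
  have q1: "q < 1" "q \<le> 1 / 2" using q by simp_all
  have "gain q (1 - q) (alternating k [True, True]) < gain q (1 - q) (False # alternating k [True])"
    using sgn_gain_even_diff[OF q(1) q1(1), of "1 - q" k] q by (auto simp: sgn_if split: if_splits)
  from optimal_words_two_candidates(1)[OF _ _ gain_less_candidates_even[OF q(1) q1(2)] this] show ?thesis
    using q q1 optimal_words_from_zero[OF q(1) q1(1), of "2 * k + 2"] by (simp add: Suc)
qed

text \<open>
  For \<open>q = 1 / 2\<close> the penalty \<open>1 - q\<close> after the first choice coincides with the break-even point \<open>q\<close>.  For length \<open>1\<close>
  no letters remain and there is no tie.
\<close>

lemma optimal_words_odd_half:
  "optimal_words (1 / 2) 0 (2 * m + 1) =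
     {alternating m [True]} \<union> (case m of 0 \<Rightarrow> {} | Suc k \<Rightarrow> {True # alternating k [True, True]})"
proof (cases m)
  case 0
  have "optimal_words (1 / 2) (1 / 2) 0 = {[]}" by (auto simp: optimal_words_def)
  thus ?thesis using optimal_words_from_zero[of "1 / 2" 0] by (simp add: 0)
next
  case (Suc k)
  have "gain (1 / 2) (1 / 2) (alternating k [True, True]) = gain (1 / 2) (1 / 2) (False # alternating k [True])"
    using sgn_gain_even_diff[of "1 / 2" "1 / 2" k] by (simp add: sgn_0_0 del: gain.simps)
  from optimal_words_two_candidates(2)[OF _ _ gain_less_candidates_even this] show ?thesis
    using optimal_words_from_zero[of "1 / 2" "2 * k + 2"] by (auto simp add: Suc)
qed

section \<open>Maximal energy and maximising tuples\<close>

lemma proper_divisors_prime_power: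
  assumes "prime p"
  shows "proper_divisors (p ^ s) = (\<lambda>a. p ^ a) ` {..<s}"
proof -
  have p: "p > 1" using assms by (rule prime_gt_1_nat)
  show ?thesis
    using p by (auto simp: proper_divisors_def divides_primepow_nat[OF assms] le_imp_power_dvd
      less_imp_le Suc_le_eq)
qed

lemma map_nth_indicator: "length w = s \<Longrightarrow> map (\<lambda>i. i \<in> {i. i < s \<and> w ! i}) [0..<s] = w"
  by (intro nth_equalityI) auto

text \<open>
  Divisor sets correspond to words of length \<open>s\<close>, and the energy is a positive multiple of the gain.
\<close>

lemma max_icg_energy_prime_power:
  assumes p: "prime p" and w: "w \<in> optimal_words (1 / p) 0 s"
  shows "max_icg_energy (p ^ s) = 2 * (real p - 1) * real p ^ (s - 1) * gain (1 / p) 0 w"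
  unfolding max_icg_energy_def
proof (rule Max_eqI)
  have p1: "p > 1" using p by (rule prime_gt_1_nat)
  let ?E = "{icg_energy (p ^ s) D | D. D \<subseteq> proper_divisors (p ^ s)}"
  have "?E = icg_energy (p ^ s) ` Pow (proper_divisors (p ^ s))" by auto
  thus "finite ?E" by (simp add: proper_divisors_prime_power[OF p])
  show "e \<le> 2 * (real p - 1) * real p ^ (s - 1) * gain (1 / p) 0 w" if e: "e \<in> ?E" for e
  proof -
    obtain A where A: "A \<subseteq> {..<s}" "e = icg_energy (p ^ s) ((\<lambda>a. p ^ a) ` A)"
      using e unfolding proper_divisors_prime_power[OF p] by (auto simp: subset_image_iff)
    have "gain (1 / p) 0 (map (\<lambda>i. i \<in> A) [0..<s]) \<le> gain (1 / p) 0 w"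
      using w by (simp add: optimal_words_def)
    thus ?thesis
      unfolding A(2) icg_energy_eq_gain[OF p A(1)] using p1 by (intro mult_left_mono) auto
  qed
  define A where "A = {i. i < s \<and> w ! i}"
  have A: "A \<subseteq> {..<s}" "map (\<lambda>i. i \<in> A) [0..<s] = w"
    using map_nth_indicator[of w s] w by (auto simp: A_def optimal_words_def)
  have "(\<lambda>a. p ^ a) ` A \<subseteq> proper_divisors (p ^ s)"
    unfolding proper_divisors_prime_power[OF p] using A(1) by (rule image_mono)
  moreover have "2 * (real p - 1) * real p ^ (s - 1) * gain (1 / p) 0 w = icg_energy (p ^ s) ((\<lambda>a. p ^ a) ` A)"
    unfolding icg_energy_eq_gain[OF p A(1)] A(2) ..
  ultimately show "2 * (real p - 1) * real p ^ (s - 1) * gain (1 / p) 0 w \<in> ?E"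
    by blast
qed

lemma maximising_tuples_conv_optimal_words:
  assumes p: "prime p" and s: "s \<ge> 1"
  shows "maximising_tuples p s =
    {a. exponent_tuple s a \<and> map (\<lambda>i. i \<in> set a) [0..<s] \<in> optimal_words (1 / p) 0 s}"
proof -
  have p1: "p > 1" using p by (rule prime_gt_1_nat)
  obtain w where w: "w \<in> optimal_words (1 / p) 0 s" using optimal_words_nonempty by blast
  have "icg_energy (p ^ s) (exponent_divisors p a) = max_icg_energy (p ^ s) \<longleftrightarrow>
      map (\<lambda>i. i \<in> set a) [0..<s] \<in> optimal_words (1 / p) 0 s" if a: "exponent_tuple s a" for a
  proof -
    have sub: "set a \<subseteq> {..<s}" using a s by (auto simp: exponent_tuple_def)
    have D: "exponent_divisors p a = (\<lambda>a. p ^ a) ` set a" by (auto simp: exponent_divisors_def)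
    have "2 * (real p - 1) * real p ^ (s - 1) \<noteq> 0" using p1 by simp
    hence "icg_energy (p ^ s) (exponent_divisors p a) = max_icg_energy (p ^ s) \<longleftrightarrow>
        gain (1 / p) 0 (map (\<lambda>i. i \<in> set a) [0..<s]) = gain (1 / p) 0 w"
      unfolding D icg_energy_eq_gain[OF p sub] max_icg_energy_prime_power[OF p w]
      by (simp only: mult_cancel_left) simp
    also have "\<dots> \<longleftrightarrow> map (\<lambda>i. i \<in> set a) [0..<s] \<in> optimal_words (1 / p) 0 s"
      using w unfolding optimal_words_def by (auto intro: order_antisym)
    finally show ?thesis .
  qed
  thus ?thesis unfolding maximising_tuples_def by blast
qed

lemma indicator_word_eq_iff:
  assumes "exponent_tuple s a" "s \<ge> 1"
  shows "map (\<lambda>i. i \<in> set a) [0..<s] = map f [0..<s] \<longleftrightarrow> a = filter f [0..<s]"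
proof
  assume eq: "map (\<lambda>i. i \<in> set a) [0..<s] = map f [0..<s]"
  \<comment> \<open>Both lists are strictly increasing, so it suffices that they have the same elements.\<close>
  show "a = filter f [0..<s]"
  proof (rule strict_sorted_equal)
    show "sorted_wrt (<) a" using assms by (simp add: exponent_tuple_def)
    show "sorted_wrt (<) (filter f [0..<s])" by (simp add: sorted_wrt_filter)
    show "set a = set (filter f [0..<s])"
      using assms eq by (force simp: exponent_tuple_def)
  qed
next
  assume "a = filter f [0..<s]"
  hence "i \<in> set a \<longleftrightarrow> f i" if "i < s" for i using that by simp
  thus "map (\<lambda>i. i \<in> set a) [0..<s] = map f [0..<s]" by (intro map_cong) simp_all
qed

lemma exponent_tuple_filter:
  assumes "i < s" "f i"
  shows "exponent_tuple s (filter f [0..<s])"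
  using assms by (auto simp: exponent_tuple_def filter_empty_conv sorted_wrt_filter)

text \<open>
  A tuple is the increasing enumeration of the positions marked in its indicator word.  The assumption on \<open>f 0\<close> guarantees that the
  enumeration is nonempty, as exponent tuples have to be.
\<close>

lemma maximising_tuples_eq_filter:
  assumes p: "prime p" and s: "s \<ge> 1"
    and opt: "optimal_words (1 / p) 0 s = (\<lambda>f. map f [0..<s]) ` F"
    and ne: "\<And>f. f \<in> F \<Longrightarrow> f 0"
  shows "maximising_tuples p s = (\<lambda>f. filter f [0..<s]) ` F"
proof -
  have "exponent_tuple s (filter f [0..<s])" if "f \<in> F" for f
    using exponent_tuple_filter[of 0 s f] ne[OF that] s by simp
  thus ?thesis
    unfolding maximising_tuples_conv_optimal_words[OF p s] opt image_iff
    using indicator_word_eq_iff[OF _ s] by blast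
qed

lemma filter_0_or_odd:
  "filter (\<lambda>i. i = 0 \<or> odd i) [0..<Suc n] = 0 # filter odd [0..<Suc n]"
proof -
  have "filter (\<lambda>i. i = 0 \<or> odd i) [Suc 0..<Suc n] = filter odd [Suc 0..<Suc n]"
    by (intro filter_cong) auto
  thus ?thesis unfolding upt_conv_Cons[OF zero_less_Suc] by simp
qed

lemma True_Cons_map_even: "True # map even [0..<n] = map (\<lambda>i. i = 0 \<or> odd i) [0..<Suc n]"
  unfolding map_upt_Suc by simp

lemma alternating_single_conv_map: "alternating m [True] = map even [0..<2 * m + 1]"
  by (simp add: alternating_conv_map)

lemma alternating_double_conv_map:
  "alternating m [True, True] = map (\<lambda>i. even i \<or> i = 2 * m + 1) [0..<2 * m + 2]"
  by (simp add: alternating_conv_map)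

lemma True_alternating_double_conv_map:
  "True # alternating m [True, True] = map (\<lambda>i. (i = 0 \<or> odd i) \<or> i = 2 * m + 2) [0..<2 * m + 3]"
proof -
  have "True # alternating m [True, True] = (True # map even [0..<2 * m + 1]) @ [True]"
    by (simp add: alternating_conv_map)
  also have "\<dots> = map (\<lambda>i. i = 0 \<or> odd i) [0..<2 * m + 2] @ [True]"
    unfolding True_Cons_map_even by simp
  also have "\<dots> = map (\<lambda>i. (i = 0 \<or> odd i) \<or> i = 2 * m + 2) ([0..<2 * m + 2] @ [2 * m + 2])"
    unfolding map_append by (intro arg_cong2[where f = "(@)"] map_cong) auto
  also have "[0..<2 * m + 2] @ [2 * m + 2] = [0..<2 * m + 3]"
    by (simp add: eval_nat_numeral)
  finally show ?thesis .
qed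

lemma filter_or_last: "filter (\<lambda>i. P i \<or> i = n) [0..<Suc n] = filter P [0..<n] @ [n]"
proof -
  have "filter (\<lambda>i. P i \<or> i = n) [0..<n] = filter P [0..<n]" by (intro filter_cong) auto
  thus ?thesis by simp
qed

lemma maximising_tuples_even:
  assumes p: "prime p" and s: "s = 2 * m + 2"
  shows "maximising_tuples p s = {filter even [0..<s] @ [s - 1], [0] @ filter odd [0..<s]}"
proof -
  have p1: "p > 1" using p by (rule prime_gt_1_nat)
  let ?F = "{\<lambda>i. even i \<or> i = 2 * m + 1, \<lambda>i. i = 0 \<or> odd i}"
  have "True # alternating m [True] = map (\<lambda>i. i = 0 \<or> odd i) [0..<s]"
    unfolding alternating_single_conv_map True_Cons_map_even s by simp
  hence "optimal_words (1 / p) 0 s = (\<lambda>f. map f [0..<s]) ` ?F"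
    using optimal_words_even[of "1 / p" m] p1
    by (simp only: s alternating_double_conv_map image_insert image_empty) (simp add: field_simps)
  hence "maximising_tuples p s = (\<lambda>f. filter f [0..<s]) ` ?F"
    by (rule maximising_tuples_eq_filter[OF p, rotated]) (use s in auto)
  also have "\<dots> = {filter (\<lambda>i. even i \<or> i = 2 * m + 1) [0..<s], filter (\<lambda>i. i = 0 \<or> odd i) [0..<s]}"
    by (simp only: image_insert image_empty)
  also have "filter (\<lambda>i. even i \<or> i = 2 * m + 1) [0..<s] = filter even [0..<s] @ [s - 1]"
    using filter_or_last[of even "2 * m + 1"] by (simp add: s)
  also have "filter (\<lambda>i. i = 0 \<or> odd i) [0..<s] = [0] @ filter odd [0..<s]"
    using filter_0_or_odd[of "2 * m + 1"] by (simp add: s)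
  finally show ?thesis .
qed

lemma maximising_tuples_odd:
  assumes p: "prime p" "p \<ge> 3" and s: "s = 2 * m + 1"
  shows "maximising_tuples p s = {filter even [0..<s]}"
proof -
  have "optimal_words (1 / p) 0 s = (\<lambda>f. map f [0..<s]) ` {even}"
    using optimal_words_odd[of "1 / p" m] p(2)
    by (simp add: s alternating_single_conv_map field_simps)
  from maximising_tuples_eq_filter[OF p(1) _ this] show ?thesis using s by simp
qed

lemma maximising_tuples_two_odd:
  assumes s: "s = 2 * m + 1"
  shows "maximising_tuples 2 s = {filter even [0..<s]} \<union>
           (if s \<ge> 3 then {[0] @ filter odd [0..<s - 1] @ [s - 1]} else {})"
proof (cases m)
  case 0
  have "optimal_words (1 / real 2) 0 s = (\<lambda>f. map f [0..<s]) ` {even}"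
    using optimal_words_odd_half[of m] by (simp add: s 0)
  from maximising_tuples_eq_filter[OF two_is_prime_nat _ this] show ?thesis using s 0 by simp
next
  case (Suc k)
  let ?f = "\<lambda>i. (i = 0 \<or> odd i) \<or> i = 2 * k + 2"
  have s': "s = Suc (2 * k + 2)" "s = 2 * k + 3" using s Suc by simp_all
  have "optimal_words (1 / 2) 0 s = {alternating m [True], True # alternating k [True, True]}"
    using optimal_words_odd_half[of m] by (auto simp: s Suc)
  also have "\<dots> = (\<lambda>f. map f [0..<s]) ` {even, ?f}"
    unfolding alternating_single_conv_map True_alternating_double_conv_map s[symmetric] s'(2)[symmetric]
    by simp
  finally have "optimal_words (1 / real 2) 0 s = (\<lambda>f. map f [0..<s]) ` {even, ?f}" by simp
  hence "maximising_tuples 2 s = (\<lambda>f. filter f [0..<s]) ` {even, ?f}"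
    by (rule maximising_tuples_eq_filter[OF two_is_prime_nat, rotated]) (use s in auto)
  also have "\<dots> = {filter even [0..<s], filter ?f [0..<s]}"
    by (simp only: image_insert image_empty)
  also have "filter ?f [0..<s] = [0] @ filter odd [0..<s - 1] @ [s - 1]"
    unfolding s'(1) filter_or_last using filter_0_or_odd[of "2 * k + 1"] by simp
  finally show ?thesis unfolding s'(2) by (simp add: insert_commute)
qed

lemma max_icg_energy_odd:
  assumes p: "prime p" and s: "s = 2 * m + 1"
  shows "max_icg_energy (p ^ s) =
          1 / (real p + 1)\<^sup>2 *
            ((real s + 1) * ((real p)\<^sup>2 - 1) * real p ^ s + 2 * (real p ^ (s + 1) - 1))"
proof -
  have p1: "p > 1" using p by (rule prime_gt_1_nat)
  hence q: "0 < 1 / real p" "1 / real p < 1" "1 / real p \<le> 1 / 2" by (auto simp: field_simps)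
  have "alternating m [True] \<in> optimal_words (1 / p) 0 s"
  proof (cases "p = 2")
    case True
    thus ?thesis using optimal_words_odd_half[of m] by (simp add: s)
  next
    case False
    hence "1 / real p < 1 / 2" using p1 by (simp add: field_simps)
    thus ?thesis using optimal_words_odd[OF q(1)] by (simp add: s)
  qed
  note E = max_icg_energy_prime_power[OF p this]
  define x where "x = real p"
  have x: "x > 1" using p1 by (simp add: x_def)
  define z where "z = x ^ (2 * m)"
  have z: "z > 0" using x by (simp add: z_def)
  have pw: "x ^ (s - 1) = z" "x ^ s = x * z" "x ^ (s + 1) = x * x * z" "(1 / x) ^ (2 * m + 2) = 1 / (x * x * z)"
    by (simp_all add: s z_def power_add power_one_over)
  have [simp]: "x + 1 \<noteq> 0" "x - 1 \<noteq> 0" "x \<noteq> 1" "x \<noteq> -1" "x \<noteq> 0" "z \<noteq> 0" using x z by auto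
  have sq: "1 - (1 / x)\<^sup>2 = (x - 1) * (x + 1) / (x * x)"
    by (simp add: field_simps power2_eq_square)
  have s1: "real s + 1 = 2 * (real m + 1)" by (simp add: s)
  have "1 + 1 / x = (x + 1) / x" by (simp add: field_simps)
  thus ?thesis
    unfolding E gain_alternating_single[OF q(1,2)]
    unfolding x_def[symmetric] pw sq s1
    by (simp add: divide_simps power2_eq_square) (simp add: algebra_simps)
qed

lemma max_icg_energy_even:
  assumes p: "prime p" and s: "s = 2 * m + 2"
  shows "max_icg_energy (p ^ s) =
          1 / (real p + 1)\<^sup>2 *
            (real s * ((real p)\<^sup>2 - 1) * real p ^ s +
             2 * (2 * real p ^ (s + 1) - real p ^ (s - 1) + (real p)\<^sup>2 - real p - 1))"
proof -
  have p1: "p > 1" using p by (rule prime_gt_1_nat)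
  hence q: "0 < 1 / real p" "1 / real p < 1" "1 / real p \<le> 1 / 2" by (auto simp: field_simps)
  have "alternating m [True, True] \<in> optimal_words (1 / p) 0 s"
    using optimal_words_even[OF q(1,3)] by (simp add: s)
  note E = max_icg_energy_prime_power[OF p this]
  define x where "x = real p"
  have x: "x > 1" using p1 by (simp add: x_def)
  define z where "z = x ^ (2 * m)"
  have z: "z > 0" using x by (simp add: z_def)
  have pw: "x ^ (s - 1) = x * z" "x ^ s = x * x * z" "x ^ (s + 1) = x * x * x * z"
    "(1 / x) ^ (2 * m + 2) = 1 / (x * x * z)"
    by (simp_all add: s z_def power_add power_one_over)
  have [simp]: "x + 1 \<noteq> 0" "x - 1 \<noteq> 0" "x \<noteq> 1" "x \<noteq> -1" "x \<noteq> 0" "z \<noteq> 0" using x z by auto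
  have sq: "1 - (1 / x)\<^sup>2 = (x - 1) * (x + 1) / (x * x)"
    by (simp add: field_simps power2_eq_square)
  have s1: "real s = 2 * (real m + 1)" by (simp add: s)
  have "1 + 1 / x = (x + 1) / x" by (simp add: field_simps)
  thus ?thesis
    unfolding E gain_alternating_double[OF q(1,2)] gain_alternating_single[OF q(1,2)]
    unfolding x_def[symmetric] pw sq s1
    by (simp add: divide_simps power2_eq_square) (simp add: algebra_simps)
qed

theorem theorem1p1:
  fixes p s :: nat
  assumes "prime p" and "s \<ge> 1"
  shows
    "(odd s \<longrightarrow>
        max_icg_energy (p ^ s) =
          1 / (real p + 1)\<^sup>2 *
            ((real s + 1) * ((real p)\<^sup>2 - 1) * real p ^ s + 2 * (real p ^ (s + 1) - 1)) \<and>
        (p \<ge> 3 \<longrightarrow> maximising_tuples p s = {filter even [0..<s]}) \<and>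
        (p = 2 \<longrightarrow> maximising_tuples p s =
           {filter even [0..<s]} \<union>
           (if s \<ge> 3 then {[0] @ filter odd [0..<s - 1] @ [s - 1]} else {}))) \<and>
     (even s \<longrightarrow>
        max_icg_energy (p ^ s) =
          1 / (real p + 1)\<^sup>2 *
            (real s * ((real p)\<^sup>2 - 1) * real p ^ s +
             2 * (2 * real p ^ (s + 1) - real p ^ (s - 1) + (real p)\<^sup>2 - real p - 1)) \<and>
        maximising_tuples p s =
          {filter even [0..<s] @ [s - 1], [0] @ filter odd [0..<s]})"
proof (intro conjI impI)
  note p = assms(1)
  {
    assume "odd s"
    then obtain m where s: "s = 2 * m + 1" by (elim oddE)
    show "max_icg_energy (p ^ s) =
          1 / (real p + 1)\<^sup>2 *
            ((real s + 1) * ((real p)\<^sup>2 - 1) * real p ^ s + 2 * (real p ^ (s + 1) - 1))"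
      using p s by (rule max_icg_energy_odd)
    show "maximising_tuples p s = {filter even [0..<s]}" if "p \<ge> 3"
      using p that s by (rule maximising_tuples_odd)
    show "maximising_tuples p s =
           {filter even [0..<s]} \<union>
           (if s \<ge> 3 then {[0] @ filter odd [0..<s - 1] @ [s - 1]} else {})" if "p = 2"
      unfolding that using s by (rule maximising_tuples_two_odd)
  }
  assume "even s"
  then obtain k where "s = 2 * k" by (elim evenE)
  with assms(2) obtain m where s: "s = 2 * m + 2" by (cases k) auto
  show "max_icg_energy (p ^ s) =
          1 / (real p + 1)\<^sup>2 *
            (real s * ((real p)\<^sup>2 - 1) * real p ^ s +
             2 * (2 * real p ^ (s + 1) - real p ^ (s - 1) + (real p)\<^sup>2 - real p - 1))"
    using p s by (rule max_icg_energy_even)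
  show "maximising_tuples p s = {filter even [0..<s] @ [s - 1], [0] @ filter odd [0..<s]}"
    using p s by (rule maximising_tuples_even)
qed

end
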